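(* Let $K$ be a field and let $M$ be a monomial ideal in $R=K[x_1,\ldots,x_n]$ with minimal monomial generating set $\mathcal{G}(M)=\{\mathbf{x}^{\mathbf{a}_i} : 1\le i\le m\}$. Assume $|\mathrm{supp}(\mathbf{x}^{\mathbf{a}_i})|=2$ for each $i=1,2,\ldots,m$. Suppose that for each $\mathbf{x}^{\mathbf{a}_i}\in\mathcal{G}(M)$ there is a variable $x_l\in\mathrm{supp}(\mathbf{x}^{\mathbf{a}_i})$ such that there exists a monomial $\mathbf{x}^{\mathbf{a}_j}\neq\mathbf{x}^{\mathbf{a}_i}$ in $\mathcal{G}(M)$ with $x_l\in\mathrm{supp}(\mathbf{x}^{\mathbf{a}_i})\cap\mathrm{supp}(\mathbf{x}^{\mathbf{a}_j})$ and $x_l\notin\mathrm{supp}(\mathbf{x}^{\mathbf{a}_k})$ for all $k\neq i,j$. Then the toric ideal $I_M$ is strongly robust.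
   Context: For a monomial $\mathbf{x}^{\mathbf{a}}$, $\mathrm{supp}(\mathbf{x}^{\mathbf{a}})$ is the set of variables $x_l$ occurring in it with nonzero exponent. The toric ideal $I_M$ is the kernel of the $K$-algebra homomorphism $\phi:K[e_1,\ldots,e_m]\to K[x_1,\ldots,x_n]$, $\phi(e_i)=\mathbf{x}^{\mathbf{a}_i}$. A nonzero binomial $\mathbf{e}^{\mathbf{u}}-\mathbf{e}^{\mathbf{v}}$ in a toric ideal $I$ is primitive if there is no other nonzero binomial $\mathbf{e}^{\mathbf{u}'}-\mathbf{e}^{\mathbf{v}'}\in I$ with $\mathbf{e}^{\mathbf{u}'}\mid\mathbf{e}^{\mathbf{u}}$ and $\mathbf{e}^{\mathbf{v}'}\mid\mathbf{e}^{\mathbf{v}}$. The Graver basis of $I$ is the set of all primitive binomials of $I$, where $f$ and $-f$ are identified. The toric ideal $I$ is strongly robust if its Graver basis is a minimal generating set of $I$ (equivalently, if the Graver basis equals the set of indispensable binomials of $I$, i.e. binomials $f\in I$ such that every system of binomial generators of $I$ contains $f$ or $-f$). *)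

theory Defs
  imports "HOL-Algebra.Ideal" "HOL-Algebra.RingHom" "HOL-Library.Poly_Mapping"
begin

text \<open>A polynomial is a finitely supported map from exponent vectors to coefficients; variables are
  indexed by natural numbers. The addition and multiplication of \<open>Poly_Mapping\<close> are those of the
  polynomial ring in countably many variables, and \<open>poly_ring n\<close> is its subring in the variables
  indexed by \<open>1, \<dots>, n\<close>.\<close>

type_synonym 'k mpoly = "(nat \<Rightarrow>\<^sub>0 nat) \<Rightarrow>\<^sub>0 'k"

text \<open>The support of a monomial, each variable being represented by its index.\<close>

abbreviation supp :: "(nat \<Rightarrow>\<^sub>0 nat) \<Rightarrow> nat set" where
  "supp u \<equiv> Poly_Mapping.keys u"

definition poly_ring :: "nat \<Rightarrow> ('k::field) mpoly ring" where
  "poly_ring n = \<lparr>carrier = {p. \<forall>u \<in> Poly_Mapping.keys p. supp u \<subseteq> {1..n}},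
     monoid.mult = (*), one = 1, zero = 0, add = (+)\<rparr>"

abbreviation monomial :: "(nat \<Rightarrow>\<^sub>0 nat) \<Rightarrow> ('k::field) mpoly" where
  "monomial u \<equiv> Poly_Mapping.single u 1"

abbreviation const :: "'k \<Rightarrow> ('k::field) mpoly" where
  "const c \<equiv> Poly_Mapping.single 0 c"

abbreviation var :: "nat \<Rightarrow> ('k::field) mpoly" where
  "var i \<equiv> monomial (Poly_Mapping.single i 1)"

definition monomial_ideal :: "nat \<Rightarrow> ('k::field) mpoly set \<Rightarrow> bool" where
  "monomial_ideal n M \<longleftrightarrow>
     (\<exists>A. (\<forall>u\<in>A. supp u \<subseteq> {1..n}) \<and> M = Idl\<^bsub>poly_ring n\<^esub> (monomial ` A))"

definition minimal_generating_set :: "('a, 'b) ring_scheme \<Rightarrow> 'a set \<Rightarrow> 'a set \<Rightarrow> bool" where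
  "minimal_generating_set R I B \<longleftrightarrow>
     B \<subseteq> carrier R \<and> Idl\<^bsub>R\<^esub> B = I \<and> (\<forall>C. C \<subset> B \<longrightarrow> Idl\<^bsub>R\<^esub> C \<noteq> I)"

text \<open>Substitution of the monomial with exponent vector \<open>a i\<close> for the \<open>i\<close>-th variable. On
  \<open>poly_ring m\<close> this is the unique algebra homomorphism with these values, see
  \<open>toric_map_ring_hom\<close>, \<open>toric_map_const\<close> and \<open>toric_map_var\<close> below.\<close>

definition toric_map :: "(nat \<Rightarrow> nat \<Rightarrow>\<^sub>0 nat) \<Rightarrow> ('k::field) mpoly \<Rightarrow> 'k mpoly" where
  "toric_map a p = (\<Sum>u\<in>Poly_Mapping.keys p. const (Poly_Mapping.lookup p u) *
     (\<Prod>i\<in>supp u. monomial (a i) ^ Poly_Mapping.lookup u i))"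

definition toric_ideal :: "nat \<Rightarrow> nat \<Rightarrow> (nat \<Rightarrow> nat \<Rightarrow>\<^sub>0 nat) \<Rightarrow> ('k::field) mpoly set" where
  "toric_ideal m n a = a_kernel (poly_ring m) (poly_ring n) (toric_map a)"

definition primitive_binomial :: "('k::field) mpoly set \<Rightarrow> 'k mpoly \<Rightarrow> bool" where
  "primitive_binomial I f \<longleftrightarrow>
     (\<exists>u v. f = monomial u - monomial v \<and> f \<noteq> 0 \<and> f \<in> I \<and>
        \<not> (\<exists>u' v'. monomial u' - monomial v' \<in> I \<and> monomial u' - monomial v' \<noteq> (0 :: 'k mpoly) \<and>
              monomial u' - monomial v' \<noteq> f \<and>
              monomial u' dvd (monomial u :: 'k mpoly) \<and> monomial v' dvd (monomial v :: 'k mpoly)))"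

text \<open>The Graver basis is the set of primitive binomials with \<open>f\<close> and \<open>- f\<close> identified: a Graver basis
  as a set of polynomials consists of exactly one representative of each class \<open>{f, - f}\<close>. (In
  characteristic 2 each class is a singleton.)\<close>

definition graver_basis :: "('k::field) mpoly set \<Rightarrow> 'k mpoly set \<Rightarrow> bool" where
  "graver_basis I B \<longleftrightarrow>
     (\<forall>f\<in>B. primitive_binomial I f) \<and>
     (\<forall>f. primitive_binomial I f \<longrightarrow> (\<exists>!g. g \<in> B \<and> (g = f \<or> g = - f)))"

text \<open>The choice of representatives is immaterial; one always exists by \<open>graver_basis_exists\<close>.\<close>

definition strongly_robust :: "nat \<Rightarrow> ('k::field) mpoly set \<Rightarrow> bool" where
  "strongly_robust m I \<longleftrightarrow>
     (\<forall>B. graver_basis I B \<longrightarrow> minimal_generating_set (poly_ring m) I B)"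

lemma graver_basis_exists: "\<exists>B. graver_basis I B"
proof -
  define r where "r = (\<lambda>f::'a mpoly. SOME g. g \<in> {f, - f} \<and> primitive_binomial I g)"
  let ?P = "{f. primitive_binomial I f}"
  have r: "(r f = f \<or> r f = - f) \<and> primitive_binomial I (r f)" if "primitive_binomial I f" for f
    using someI[of "\<lambda>g. g \<in> {f, - f} \<and> primitive_binomial I g" f] that unfolding r_def by auto
  have r_minus: "r (- f) = r f" for f
    unfolding r_def by (simp add: insert_commute)
  have "graver_basis I (r ` ?P)"
    unfolding graver_basis_def
  proof (intro conjI ballI allI impI)
    fix f assume "f \<in> r ` ?P" then show "primitive_binomial I f" using r by auto
  next
    fix f assume f: "primitive_binomial I f"
    show "\<exists>!g. g \<in> r ` ?P \<and> (g = f \<or> g = - f)"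
    proof (rule ex1I[of _ "r f"])
      show "r f \<in> r ` ?P \<and> (r f = f \<or> r f = - f)" using r f by auto
    next
      fix g assume g: "g \<in> r ` ?P \<and> (g = f \<or> g = - f)"
      then obtain h where h: "primitive_binomial I h" "g = r h" by auto
      have "g = h \<or> g = - h" using r h by auto
      with g have "h = f \<or> h = - f" by auto
      with h r_minus show "g = r f" by auto
    qed
  qed
  then show ?thesis by blast
qed

lemma poly_ring_simps [simp]:
  "carrier (poly_ring n) = {p. \<forall>u \<in> Poly_Mapping.keys p. supp u \<subseteq> {1..n}}"
  "x \<otimes>\<^bsub>poly_ring n\<^esub> y = x * y" "\<one>\<^bsub>poly_ring n\<^esub> = 1" "\<zero>\<^bsub>poly_ring n\<^esub> = 0" "x \<oplus>\<^bsub>poly_ring n\<^esub> y = x + y"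
  by (simp_all add: poly_ring_def)

lemma poly_ring_add_closed:
  assumes "\<forall>u\<in>Poly_Mapping.keys p. supp u \<subseteq> {1..n}" "\<forall>u\<in>Poly_Mapping.keys q. supp u \<subseteq> {1..n}"
  shows "\<forall>u\<in>Poly_Mapping.keys (p + q). Poly_Mapping.keys u \<subseteq> {1..n::nat}"
  using assms keys_add[of p q] by blast

lemma poly_ring_mult_closed:
  fixes p q :: "('k::field) mpoly"
  assumes "\<forall>u\<in>Poly_Mapping.keys p. supp u \<subseteq> {1..n}" "\<forall>u\<in>Poly_Mapping.keys q. supp u \<subseteq> {1..n}"
  shows "\<forall>u\<in>Poly_Mapping.keys (p * q). Poly_Mapping.keys u \<subseteq> {1..n::nat}"
proof
  fix u assume "u \<in> Poly_Mapping.keys (p * q)"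
  then obtain v w where "v \<in> Poly_Mapping.keys p" "w \<in> Poly_Mapping.keys q" "u = v + w"
    using keys_mult[of p q] by blast
  then show "supp u \<subseteq> {1..n}" using assms keys_add[of v w] by blast
qed

lemma keys_uminus_poly: "Poly_Mapping.keys (- p) = Poly_Mapping.keys (p :: ('k::field) mpoly)"
  by (auto simp: in_keys_iff)

lemma cring_poly_ring: "cring (poly_ring n :: ('k::field) mpoly ring)"
proof (rule cringI)
  show "abelian_group (poly_ring n :: 'k mpoly ring)"
  proof (rule abelian_groupI)
    fix x y z :: "'k mpoly"
    show "x \<oplus>\<^bsub>poly_ring n\<^esub> y = y \<oplus>\<^bsub>poly_ring n\<^esub> x" by (simp add: add.commute)
    show "x \<oplus>\<^bsub>poly_ring n\<^esub> y \<oplus>\<^bsub>poly_ring n\<^esub> z = x \<oplus>\<^bsub>poly_ring n\<^esub> (y \<oplus>\<^bsub>poly_ring n\<^esub> z)"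
      by (simp add: add.assoc)
    show "\<zero>\<^bsub>poly_ring n\<^esub> \<oplus>\<^bsub>poly_ring n\<^esub> x = x" by simp
    show "\<zero>\<^bsub>poly_ring n\<^esub> \<in> carrier (poly_ring n :: 'k mpoly ring)" by simp
    assume x: "x \<in> carrier (poly_ring n)"
    then show "\<exists>y\<in>carrier (poly_ring n). y \<oplus>\<^bsub>poly_ring n\<^esub> x = \<zero>\<^bsub>poly_ring n\<^esub>"
      by (intro bexI[of _ "- x"]) (simp_all add: keys_uminus_poly)
    assume "y \<in> carrier (poly_ring n)"
    with x show "x \<oplus>\<^bsub>poly_ring n\<^esub> y \<in> carrier (poly_ring n)"
      unfolding poly_ring_simps mem_Collect_eq by (rule poly_ring_add_closed)
  qed
  show "comm_monoid (poly_ring n :: 'k mpoly ring)"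
  proof (rule comm_monoidI)
    fix x y z :: "'k mpoly"
    show "x \<otimes>\<^bsub>poly_ring n\<^esub> y = y \<otimes>\<^bsub>poly_ring n\<^esub> x" by (simp add: mult.commute)
    show "x \<otimes>\<^bsub>poly_ring n\<^esub> y \<otimes>\<^bsub>poly_ring n\<^esub> z = x \<otimes>\<^bsub>poly_ring n\<^esub> (y \<otimes>\<^bsub>poly_ring n\<^esub> z)"
      by (simp add: mult.assoc)
    show "\<one>\<^bsub>poly_ring n\<^esub> \<otimes>\<^bsub>poly_ring n\<^esub> x = x" by simp
    show "\<one>\<^bsub>poly_ring n\<^esub> \<in> carrier (poly_ring n :: 'k mpoly ring)" by simp
    assume "x \<in> carrier (poly_ring n)" "y \<in> carrier (poly_ring n)"
    then show "x \<otimes>\<^bsub>poly_ring n\<^esub> y \<in> carrier (poly_ring n)"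
      unfolding poly_ring_simps mem_Collect_eq by (rule poly_ring_mult_closed)
  qed
qed (simp add: distrib_right)

lemma toric_map_superset:
  assumes "finite A" "Poly_Mapping.keys p \<subseteq> A"
  shows "toric_map a p = (\<Sum>u\<in>A. const (Poly_Mapping.lookup p u) *
    (\<Prod>i\<in>supp u. monomial (a i) ^ Poly_Mapping.lookup u i))"
  unfolding toric_map_def
  by (rule sum.mono_neutral_left) (use assms in \<open>auto simp: in_keys_iff\<close>)

lemma toric_map_add: "toric_map a (p + q) = toric_map a p + toric_map a q"
proof -
  let ?A = "Poly_Mapping.keys p \<union> Poly_Mapping.keys q"
  have fin: "finite ?A" by simp
  show ?thesis
    unfolding toric_map_superset[OF fin keys_add] toric_map_superset[OF fin Un_upper1]
      toric_map_superset[OF fin Un_upper2] lookup_add single_add distrib_right sum.distrib ..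
qed

lemma toric_map_single:
  "toric_map a (Poly_Mapping.single u c) = const c * (\<Prod>i\<in>supp u. monomial (a i) ^ Poly_Mapping.lookup u i)"
  by (subst toric_map_superset[of "{u}"]) (auto simp: keys_single split: if_splits)

lemma toric_map_const: "toric_map a (const c) = const c"
  by (simp add: toric_map_single)

lemma toric_map_var: "toric_map a (var i) = monomial (a i)"
  by (simp add: toric_map_single)

lemma prod_power_add:
  fixes x :: "nat \<Rightarrow> 'r::comm_monoid_mult"
  shows "(\<Prod>i\<in>Poly_Mapping.keys (u + v). x i ^ Poly_Mapping.lookup (u + v) i) =
    (\<Prod>i\<in>Poly_Mapping.keys u. x i ^ Poly_Mapping.lookup u i) * (\<Prod>i\<in>Poly_Mapping.keys v. x i ^ Poly_Mapping.lookup v i)"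
proof -
  have *: "(\<Prod>i\<in>Poly_Mapping.keys w. x i ^ Poly_Mapping.lookup w i) = (\<Prod>i\<in>Poly_Mapping.keys u \<union> Poly_Mapping.keys v. x i ^ Poly_Mapping.lookup w i)"
    if "Poly_Mapping.keys w \<subseteq> Poly_Mapping.keys u \<union> Poly_Mapping.keys v" for w
    by (rule prod.mono_neutral_left) (use that in \<open>auto simp: in_keys_iff\<close>)
  show ?thesis
    using *[of u] *[of v] *[OF keys_add] by (simp add: lookup_add power_add prod.distrib)
qed

lemma mpoly_induct [case_names zero single_add]:
  fixes p :: "('k::field) mpoly"
  assumes "P 0" "\<And>u c q. P q \<Longrightarrow> P (Poly_Mapping.single u c + q)"
  shows "P p"
proof (induction p rule: update_induct)
  case const
  have "Abs_poly_mapping (\<lambda>_. 0) = (0 :: 'k mpoly)" by simp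
  with assms(1) show ?case by simp
next
  case (update f u c)
  then have "Poly_Mapping.update u c f = Poly_Mapping.single u c + f"
    by (intro poly_mapping_eqI) (auto simp: lookup_update lookup_add lookup_single in_keys_iff when_def)
  with update assms(2) show ?case by simp
qed

lemma toric_map_mult: "toric_map a (p * q) = toric_map a p * toric_map a q"
proof (induction p rule: mpoly_induct)
  case zero
  then show ?case by (simp add: toric_map_def)
next
  case (single_add u c p)
  have "toric_map a (Poly_Mapping.single u c * q) = toric_map a (Poly_Mapping.single u c) * toric_map a q"
  proof (induction q rule: mpoly_induct)
    case zero
    then show ?case by (simp add: toric_map_def)
  next
    case (single_add v d q)
    have "const (c * d) = const c * const d" by (simp add: mult_single)
    with single_add show ?case
      by (simp add: distrib_left toric_map_add mult_single toric_map_single prod_power_add mult_ac)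
  qed
  with single_add show ?case by (simp add: distrib_right toric_map_add)
qed

lemma toric_map_ring_hom:
  assumes "\<And>i. i \<in> {1..m} \<Longrightarrow> supp (a i) \<subseteq> {1..n}"
  shows "toric_map a \<in> ring_hom (poly_ring m) (poly_ring n :: ('k::field) mpoly ring)"
proof (rule ring_hom_memI)
  interpret S: cring "poly_ring n :: 'k mpoly ring" by (rule cring_poly_ring)
  fix p :: "'k mpoly" assume p: "p \<in> carrier (poly_ring m)"
  have pow: "monomial (a i) ^ k \<in> carrier (poly_ring n :: 'k mpoly ring)" if "i \<in> {1..m}" for i and k :: nat
  proof (induction k)
    case (Suc k)
    have "(monomial (a i) :: 'k mpoly) \<in> carrier (poly_ring n)" using assms that by auto
    from S.m_closed[OF this Suc] show ?case by simp
  qed simp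
  have prod: "(\<Prod>i\<in>A. monomial (a i) ^ k i) \<in> carrier (poly_ring n :: 'k mpoly ring)"
    if "finite A" "A \<subseteq> {1..m}" for A k
    using that
  proof (induction A rule: finite_induct)
    case (insert i A)
    then show ?case using S.m_closed[OF pow[of i "k i"] insert.IH] by simp
  qed simp
  have sum: "(\<Sum>u\<in>A. const (Poly_Mapping.lookup p u) *
    (\<Prod>i\<in>supp u. monomial (a i) ^ Poly_Mapping.lookup u i))
      \<in> carrier (poly_ring n :: 'k mpoly ring)"
    if "finite A" "A \<subseteq> Poly_Mapping.keys p" for A
    using that
  proof (induction A rule: finite_induct)
    case (insert u A)
    have "(const (Poly_Mapping.lookup p u) :: 'k mpoly) \<in> carrier (poly_ring n)" by auto
    from S.a_closed[OF S.m_closed[OF this prod[of "Poly_Mapping.keys u" "Poly_Mapping.lookup u"]] insert.IH] insert p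
    show ?case by simp
  qed simp
  show "toric_map a p \<in> carrier (poly_ring n)"
    unfolding toric_map_def by (rule sum) auto
next
  show "toric_map a \<one>\<^bsub>poly_ring m\<^esub> = \<one>\<^bsub>poly_ring n :: 'k mpoly ring\<^esub>"
    using toric_map_const[of a "1::'k"] by simp
qed (simp_all only: poly_ring_simps toric_map_add toric_map_mult)

end

theory Submission
  imports Complex_Main Defs
begin

text \<open>A variable that occurs in exactly two generators \<open>a i\<close> and \<open>a j\<close> forces \<open>e\<^sub>i\<close> and \<open>e\<^sub>j\<close> to
  occur on opposite sides, with a fixed ratio of exponents, in every binomial of the toric ideal
  whose two monomials are coprime. Hence if \<open>u - v\<close> and \<open>u' - v'\<close> are primitive and \<open>u'\<close> divides
  \<open>u\<close>, then \<open>v'\<close> divides \<open>v\<close>, so the two coincide by primitivity. Therefore, among the primitive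
  binomials up to sign, only \<open>\<plusminus>(u - v)\<close> has a monomial dividing \<open>u\<close>, and \<open>u - v\<close> does not lie in
  the ideal generated by the others.\<close>

section \<open>Divisibility of monomials in terms of exponent vectors\<close>

definition mon_le :: "(nat \<Rightarrow>\<^sub>0 nat) \<Rightarrow> (nat \<Rightarrow>\<^sub>0 nat) \<Rightarrow> bool" where
  "mon_le u v \<longleftrightarrow> (\<forall>i. Poly_Mapping.lookup u i \<le> Poly_Mapping.lookup v i)"

lemma mon_le_refl: "mon_le u u"
  by (simp add: mon_le_def)

lemma mon_le_antisym: "mon_le u v \<Longrightarrow> mon_le v u \<Longrightarrow> u = v"
  by (intro poly_mapping_eqI) (simp add: mon_le_def le_antisym)

lemma mon_le_iff_ex_add: "mon_le u v \<longleftrightarrow> (\<exists>d. v = u + d)"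
proof
  assume "mon_le u v"
  then have "v = u + (v - u)"
    by (intro poly_mapping_eqI) (simp add: mon_le_def lookup_add lookup_minus)
  then show "\<exists>d. v = u + d" ..
qed (auto simp: mon_le_def lookup_add)

lemma mon_le_supp: "mon_le u v \<Longrightarrow> supp u \<subseteq> supp v"
  by (metis in_keys_iff le_zero_eq mon_le_def subsetI)

lemma supp_add: "supp (u + v) = supp u \<union> supp v"
  by (auto simp: in_keys_iff lookup_add)

lemma monomial_mult: "monomial u * monomial v = (monomial (u + v) :: ('k::field) mpoly)"
  by (simp add: mult_single)

lemma monomial_dvd_iff: "(monomial u :: ('k::field) mpoly) dvd monomial v \<longleftrightarrow> mon_le u v"
proof
  assume "(monomial u :: 'k mpoly) dvd monomial v"
  then obtain q :: "'k mpoly" where q: "monomial v = monomial u * q" ..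
  \<comment> \<open>The cofactor \<open>q\<close> may be any polynomial, but every key of
    \<open>monomial u * q\<close> is \<open>u\<close> plus a key of \<open>q\<close>.\<close>
  have "v \<in> Poly_Mapping.keys (monomial v :: 'k mpoly)" by simp
  then have "\<exists>d. v = u + d"
    unfolding q using keys_mult[of "monomial u :: 'k mpoly" q] by auto
  then show "mon_le u v" by (simp add: mon_le_iff_ex_add)
next
  assume "mon_le u v"
  then obtain d where "v = u + d" by (auto simp: mon_le_iff_ex_add)
  then show "(monomial u :: 'k mpoly) dvd monomial v"
    by (metis dvd_triv_left monomial_mult)
qed

lemma monomial_eq_iff: "(monomial u :: ('k::field) mpoly) = monomial v \<longleftrightarrow> u = v"
  by (metis keys_single one_neq_zero singleton_inject)

lemma keys_binomial:
  assumes "u \<noteq> v"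
  shows "Poly_Mapping.keys (monomial u - monomial v :: ('k::field) mpoly) = {u, v}"
  using assms by (auto simp: in_keys_iff lookup_minus lookup_single when_def split: if_splits)

subsection \<open>Binomials in the toric ideal\<close>

text \<open>The inner sum is the \<open>lookup u i\<close>-fold multiple of \<open>a i\<close>.\<close>

definition toric_exp :: "(nat \<Rightarrow> nat \<Rightarrow>\<^sub>0 nat) \<Rightarrow> (nat \<Rightarrow>\<^sub>0 nat) \<Rightarrow> (nat \<Rightarrow>\<^sub>0 nat)" where
  "toric_exp a u = (\<Sum>i\<in>supp u. \<Sum>_<Poly_Mapping.lookup u i. a i)"

lemma monomial_power: "(monomial w :: ('k::field) mpoly) ^ k = monomial (\<Sum>_<k. w)"
  by (induction k) (simp_all add: mult_single add.commute del: sum_constant)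

lemma prod_monomial:
  "finite A \<Longrightarrow> (\<Prod>i\<in>A. monomial (f i) :: ('k::field) mpoly) = monomial (\<Sum>i\<in>A. f i)"
  by (induction A rule: finite_induct) (simp_all add: mult_single)

lemma toric_map_single_exp:
  "toric_map a (Poly_Mapping.single u c :: ('k::field) mpoly) = Poly_Mapping.single (toric_exp a u) c"
  unfolding toric_map_single toric_exp_def monomial_power prod_monomial[OF finite_keys]
  by (simp add: mult_single)

text \<open>Inherited from the multiplicativity of \<open>toric_map\<close>. The field
  \<open>rat\<close> is an arbitrary choice: over every field a monomial determines its exponent
  vector.\<close>

lemma toric_exp_add: "toric_exp a (u + v) = toric_exp a u + toric_exp a v"
proof -
  have "(monomial (toric_exp a (u + v)) :: rat mpoly) = monomial (toric_exp a u + toric_exp a v)"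
    unfolding toric_map_single_exp[symmetric] monomial_mult[symmetric] toric_map_mult ..
  then show ?thesis by (simp only: monomial_eq_iff)
qed

lemma lookup_toric_exp:
  assumes "supp u \<subseteq> {1..m}"
  shows "Poly_Mapping.lookup (toric_exp a u) l =
    (\<Sum>i\<in>{1..m}. Poly_Mapping.lookup u i * Poly_Mapping.lookup (a i) l)"
proof -
  have "Poly_Mapping.lookup (toric_exp a u) l =
    (\<Sum>i\<in>supp u. Poly_Mapping.lookup u i * Poly_Mapping.lookup (a i) l)"
    unfolding toric_exp_def lookup_sum by simp
  also have "\<dots> = (\<Sum>i\<in>{1..m}. Poly_Mapping.lookup u i * Poly_Mapping.lookup (a i) l)"
    by (rule sum.mono_neutral_left) (use assms in \<open>auto simp: in_keys_iff\<close>)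
  finally show ?thesis .
qed

text \<open>In the row of a variable confined to two generators all other terms vanish. Comparing
  this row for the two monomials of a binomial gives the linear relation behind the divisibility
  argument.\<close>

lemma lookup_toric_exp_two:
  assumes "supp u \<subseteq> {1..m}" "i \<in> {1..m}" "j \<in> {1..m}" "i \<noteq> j"
    and "\<And>k. k \<in> {1..m} \<Longrightarrow> k \<noteq> i \<Longrightarrow> k \<noteq> j \<Longrightarrow> l \<notin> supp (a k)"
  shows "Poly_Mapping.lookup (toric_exp a u) l =
    Poly_Mapping.lookup u i * Poly_Mapping.lookup (a i) l +
    Poly_Mapping.lookup u j * Poly_Mapping.lookup (a j) l"
proof -
  have "(\<Sum>k\<in>{1..m}. Poly_Mapping.lookup u k * Poly_Mapping.lookup (a k) l) =
    (\<Sum>k\<in>{i, j}. Poly_Mapping.lookup u k * Poly_Mapping.lookup (a k) l)"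
    by (rule sum.mono_neutral_right) (use assms in \<open>auto simp: in_keys_iff\<close>)
  then show ?thesis using assms(1,4) by (simp add: lookup_toric_exp)
qed

lemma mem_toric_ideal:
  "p \<in> toric_ideal m n a \<longleftrightarrow>
    (\<forall>u\<in>Poly_Mapping.keys p. supp u \<subseteq> {1..m}) \<and> toric_map a p = (0 :: ('k::field) mpoly)"
  by (simp add: toric_ideal_def a_kernel_def')

lemma toric_map_binomial:
  "toric_map a (Poly_Mapping.single u c - Poly_Mapping.single v c :: ('k::field) mpoly) =
    Poly_Mapping.single (toric_exp a u) c - Poly_Mapping.single (toric_exp a v) c"
proof -
  have "Poly_Mapping.single u c - Poly_Mapping.single v c =
      Poly_Mapping.single u c + Poly_Mapping.single v (- c)" for u v :: "nat \<Rightarrow>\<^sub>0 nat"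
    by (simp add: single_uminus)
  then show ?thesis by (simp only: toric_map_add toric_map_single_exp)
qed

text \<open>Whether a nonzero binomial lies in the toric ideal depends on exponents only, so the
  field and \<open>n\<close> disappear from the combinatorial part; \<open>toric_rel_iff\<close> is
  the link.\<close>

definition toric_rel :: "nat \<Rightarrow> (nat \<Rightarrow> nat \<Rightarrow>\<^sub>0 nat) \<Rightarrow> (nat \<Rightarrow>\<^sub>0 nat) \<Rightarrow> (nat \<Rightarrow>\<^sub>0 nat) \<Rightarrow> bool" where
  "toric_rel m a u v \<longleftrightarrow>
     u \<noteq> v \<and> supp u \<subseteq> {1..m} \<and> supp v \<subseteq> {1..m} \<and> toric_exp a u = toric_exp a v"

lemma toric_rel_iff:
  "toric_rel m a u v \<longleftrightarrow>
    monomial u - monomial v \<in> (toric_ideal m n a :: ('k::field) mpoly set) \<and>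
    monomial u - monomial v \<noteq> (0 :: 'k mpoly)"
  by (cases "u = v")
    (auto simp: toric_rel_def mem_toric_ideal keys_binomial toric_map_binomial monomial_eq_iff)

lemma toric_rel_sym: "toric_rel m a u v \<Longrightarrow> toric_rel m a v u"
  by (auto simp: toric_rel_def)

subsection \<open>Primitive pairs\<close>

definition prim :: "nat \<Rightarrow> (nat \<Rightarrow> nat \<Rightarrow>\<^sub>0 nat) \<Rightarrow> (nat \<Rightarrow>\<^sub>0 nat) \<Rightarrow> (nat \<Rightarrow>\<^sub>0 nat) \<Rightarrow> bool" where
  "prim m a u v \<longleftrightarrow> toric_rel m a u v \<and>
     (\<forall>u' v'. toric_rel m a u' v' \<longrightarrow> mon_le u' u \<longrightarrow> mon_le v' v \<longrightarrow> u' = u \<and> v' = v)"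

lemma prim_sym: "prim m a u v \<Longrightarrow> prim m a v u"
  unfolding prim_def by (blast dest: toric_rel_sym)

text \<open>In characteristic 2 a binomial determines its two monomials only up to order, but the
  exchanged pair cannot satisfy both divisibilities.\<close>

lemma binomial_eq_imp:
  assumes "u \<noteq> v" "mon_le u' u" "mon_le v' v"
    and eq: "monomial u' - monomial v' = (monomial u - monomial v :: ('k::field) mpoly)"
  shows "u' = u \<and> v' = v"
proof -
  have "u' \<noteq> v'" using eq assms(1) by (auto simp: monomial_eq_iff)
  then have "{u', v'} = {u, v}" using eq assms(1) keys_binomial by metis
  then show ?thesis using assms mon_le_antisym by (auto simp: doubleton_eq_iff)
qed

text \<open>The polynomial notion exempts competitors equal to \<open>f\<close>, while
  \<open>prim\<close> exempts only the pair \<open>u\<close>, \<open>v\<close> itself;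
  \<open>binomial_eq_imp\<close> shows that for divisors this is the same.\<close>

lemma primitive_binomial_iff:
  "primitive_binomial (toric_ideal m n a) (f :: ('k::field) mpoly) \<longleftrightarrow>
    (\<exists>u v. prim m a u v \<and> f = monomial u - monomial v)" (is "?L \<longleftrightarrow> ?R")
proof
  assume ?L
  then obtain u v where uv: "f = monomial u - monomial v" "toric_rel m a u v"
    and min: "\<And>u' v'. toric_rel m a u' v' \<Longrightarrow> monomial u' - monomial v' \<noteq> f \<Longrightarrow>
      mon_le u' u \<Longrightarrow> mon_le v' v \<Longrightarrow> False"
    unfolding primitive_binomial_def monomial_dvd_iff
    by (metis toric_rel_iff[where 'k = 'k and n = n])
  have "prim m a u v"
    unfolding prim_def using uv min binomial_eq_imp[where 'k = 'k] by (metis toric_rel_def)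
  with uv show ?R by blast
next
  assume ?R
  then obtain u v where uv: "prim m a u v" "f = monomial u - monomial v" by blast
  then have rel: "toric_rel m a u v" by (simp add: prim_def)
  have mem: "f \<in> toric_ideal m n a \<and> f \<noteq> 0"
    using rel unfolding uv(2) toric_rel_iff[where 'k = 'k and n = n] .
  have "\<not> (\<exists>u' v'. monomial u' - monomial v' \<in> (toric_ideal m n a :: 'k mpoly set) \<and>
      monomial u' - monomial v' \<noteq> (0 :: 'k mpoly) \<and> monomial u' - monomial v' \<noteq> f \<and>
      mon_le u' u \<and> mon_le v' v)"
  proof (intro notI, elim exE conjE)
    fix u' v'
    assume "monomial u' - monomial v' \<in> (toric_ideal m n a :: 'k mpoly set)"
      and "monomial u' - monomial v' \<noteq> (0 :: 'k mpoly)"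
    then have "toric_rel m a u' v'" using toric_rel_iff by blast
    moreover assume "monomial u' - monomial v' \<noteq> f" "mon_le u' u" "mon_le v' v"
    ultimately show False using uv unfolding prim_def by blast
  qed
  then show ?L
    unfolding primitive_binomial_def monomial_dvd_iff using uv(2) mem by blast
qed

text \<open>A common variable could be cancelled: \<open>toric_exp\<close> is additive, so the
  quotient pair would again be a toric binomial, properly dividing the given one.\<close>

lemma prim_coprime:
  assumes "prim m a u v"
  shows "Poly_Mapping.lookup u i = 0 \<or> Poly_Mapping.lookup v i = 0"
proof (rule ccontr)
  assume "\<not> ?thesis"
  then have pos: "Poly_Mapping.lookup u i \<ge> 1" "Poly_Mapping.lookup v i \<ge> 1" by auto
  let ?w = "Poly_Mapping.single i 1 :: nat \<Rightarrow>\<^sub>0 nat"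
  have "mon_le ?w u" "mon_le ?w v"
    using pos by (auto simp: mon_le_def lookup_single when_def)
  then obtain u' v' where uv: "u = ?w + u'" "v = ?w + v'" by (auto simp: mon_le_iff_ex_add)
  have "toric_rel m a u' v'"
    using assms unfolding uv prim_def toric_rel_def supp_add toric_exp_add by auto
  moreover have "mon_le u' u" "mon_le v' v"
    by (auto simp: uv mon_le_def lookup_add)
  ultimately have "u' = u" using assms by (auto simp: prim_def)
  then have "Poly_Mapping.lookup u i = Poly_Mapping.lookup (?w + u) i" using uv(1) by metis
  then show False by (simp add: lookup_add)
qed

text \<open>The combinatorial hypothesis of the theorem, phrased with indices:
  \<open>j \<noteq> i\<close> stands in place of \<open>a j \<noteq> a i\<close>.\<close>

definition paired :: "nat \<Rightarrow> (nat \<Rightarrow> nat \<Rightarrow>\<^sub>0 nat) \<Rightarrow> bool" where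
  "paired m a \<longleftrightarrow> (\<forall>i\<in>{1..m}. \<exists>l\<in>supp (a i). \<exists>j\<in>{1..m}. j \<noteq> i \<and> l \<in> supp (a j) \<and>
     (\<forall>k\<in>{1..m}. k \<noteq> i \<and> k \<noteq> j \<longrightarrow> l \<notin> supp (a k)))"

text \<open>Primitivity of \<open>u\<close>, \<open>v\<close> reduces the claim to \<open>v'\<close>
  dividing \<open>v\<close>, which is checked at each \<open>i\<close>. With subscripts for
  exponents, the row of the shared variable gives
  \<open>v'_i p \<le> u'_j q \<le> u_j q \<le> v_i p\<close>.\<close>

lemma prim_eq_if_mon_le:
  assumes "paired m a" and uv: "prim m a u v" and uv': "prim m a u' v'" and le: "mon_le u' u"
  shows "u' = u \<and> v' = v"
proof -
  have "Poly_Mapping.lookup v' i \<le> Poly_Mapping.lookup v i" for i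
  proof (cases "Poly_Mapping.lookup v' i = 0")
    case False
    have supps: "supp u \<subseteq> {1..m}" "supp v \<subseteq> {1..m}" "supp u' \<subseteq> {1..m}" "supp v' \<subseteq> {1..m}"
      and exps: "toric_exp a u = toric_exp a v" "toric_exp a u' = toric_exp a v'"
      using uv uv' by (auto simp: prim_def toric_rel_def)
    have i: "i \<in> {1..m}" using False supps(4) by (metis in_keys_iff subsetD)
    then obtain l j where lj: "l \<in> supp (a i)" "j \<in> {1..m}" "j \<noteq> i" "l \<in> supp (a j)"
      and other: "\<And>k. k \<in> {1..m} \<Longrightarrow> k \<noteq> i \<Longrightarrow> k \<noteq> j \<Longrightarrow> l \<notin> supp (a k)"
      using assms(1) unfolding paired_def by metis
    define p q where "p = Poly_Mapping.lookup (a i) l" and "q = Poly_Mapping.lookup (a j) l"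
    have pos: "p > 0" "q > 0" using lj by (auto simp: p_def q_def in_keys_iff)
    have row: "Poly_Mapping.lookup (toric_exp a w) l =
        Poly_Mapping.lookup w i * p + Poly_Mapping.lookup w j * q" if "supp w \<subseteq> {1..m}" for w
      unfolding p_def q_def using lookup_toric_exp_two[OF that i lj(2) lj(3)[symmetric] other] .
    note coprime = prim_coprime[OF uv] and coprime' = prim_coprime[OF uv']
    \<comment> \<open>Coprimality removes \<open>e_i\<close> from \<open>u'\<close>, so only
      \<open>e_j\<close> contributes to row \<open>l\<close> on that side.\<close>
    have "Poly_Mapping.lookup u' i = 0" using coprime'[of i] False by simp
    then have eq': "Poly_Mapping.lookup u' j * q =
        Poly_Mapping.lookup v' i * p + Poly_Mapping.lookup v' j * q"
      using row[OF supps(3)] row[OF supps(4)] exps(2) by simp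
    \<comment> \<open>The right-hand side is positive, so \<open>e_j\<close> divides
      \<open>u'\<close> and hence \<open>u\<close>; coprimality then removes it from
      \<open>v\<close>.\<close>
    with False pos have "Poly_Mapping.lookup u' j > 0" by (intro Nat.gr0I) auto
    moreover have le_j: "Poly_Mapping.lookup u' j \<le> Poly_Mapping.lookup u j"
      using le by (simp add: mon_le_def)
    ultimately have "Poly_Mapping.lookup v j = 0" using coprime[of j] by simp
    \<comment> \<open>The contribution of \<open>e_i\<close> to \<open>u\<close> is dropped, which
      leaves an inequality.\<close>
    then have "Poly_Mapping.lookup u j * q \<le> Poly_Mapping.lookup v i * p"
      using row[OF supps(1)] row[OF supps(2)] exps(1) by simp
    moreover have "Poly_Mapping.lookup u' j * q \<le> Poly_Mapping.lookup u j * q"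
      using le_j by simp
    ultimately have "Poly_Mapping.lookup v' i * p \<le> Poly_Mapping.lookup v i * p"
      using eq' by linarith
    with pos show ?thesis by simp
  qed simp
  then show ?thesis using uv uv' le unfolding prim_def mon_le_def by blast
qed

subsection \<open>Generation by primitive binomials\<close>

definition mdeg :: "nat \<Rightarrow> (nat \<Rightarrow>\<^sub>0 nat) \<Rightarrow> nat" where
  "mdeg m u = (\<Sum>i\<in>{1..m}. Poly_Mapping.lookup u i)"

lemma mdeg_add: "mdeg m (u + v) = mdeg m u + mdeg m v"
  by (simp add: mdeg_def lookup_add sum.distrib)

lemma mdeg_eq_0_iff:
  assumes "supp u \<subseteq> {1..m}"
  shows "mdeg m u = 0 \<longleftrightarrow> u = 0"
proof
  assume "mdeg m u = 0"
  then have "Poly_Mapping.lookup u i = 0" for i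
    using assms by (cases "i \<in> {1..m}") (auto simp: mdeg_def in_keys_iff)
  then show "u = 0" by (intro poly_mapping_eqI) simp
qed (simp add: mdeg_def)

text \<open>Induction on the total degree of both monomials. A binomial that is not primitive has a
  smaller pair \<open>u'\<close>, \<open>v'\<close> dividing it; with cofactors \<open>d\<close>,
  \<open>e\<close>, the identity \<open>u - v = d (u' - v') + v' (d - e)\<close>, read
  multiplicatively, reduces it to two binomials of smaller degree.\<close>

lemma binomial_mem_of_prim:
  fixes J :: "('k::field) mpoly set"
  assumes J: "ideal J (poly_ring m)"
    and prim: "\<And>u v. prim m a u v \<Longrightarrow> monomial u - monomial v \<in> J"
    and "toric_rel m a u v"
  shows "monomial u - monomial v \<in> J"
  using assms(3)
proof (induction "mdeg m u + mdeg m v" arbitrary: u v rule: less_induct)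
  case less
  interpret J: ideal J "poly_ring m" by (fact J)
  show ?case
  proof (cases "prim m a u v")
    case False
    then obtain u' v' where rel': "toric_rel m a u' v'" and le: "mon_le u' u" "mon_le v' v"
      and ne: "\<not> (u' = u \<and> v' = v)"
      using less.prems unfolding prim_def by blast
    obtain d e where d: "u = u' + d" and e: "v = v' + e" using le by (auto simp: mon_le_iff_ex_add)
    have supps: "supp d \<subseteq> {1..m}" "supp e \<subseteq> {1..m}" "supp u' \<subseteq> {1..m}" "supp v' \<subseteq> {1..m}"
      using less.prems by (auto simp: toric_rel_def d e supp_add)
    have exps: "toric_exp a d = toric_exp a e"
      using less.prems rel' by (simp add: toric_rel_def d e toric_exp_add)
    have "\<not> (d = 0 \<and> e = 0)" using ne by (auto simp: d e)
    then have "mdeg m d + mdeg m e > 0"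
      using mdeg_eq_0_iff[OF supps(1)] mdeg_eq_0_iff[OF supps(2)] by linarith
    then have 1: "monomial u' - monomial v' \<in> J"
      by (intro less.hyps rel') (simp add: d e mdeg_add)
    \<comment> \<open>Conversely \<open>u'\<close> and \<open>v'\<close> are not both trivial, so
      the cofactors have smaller degree too. They may coincide, which \<open>toric_rel\<close>
      excludes; that case is treated separately.\<close>
    have "\<not> (u' = 0 \<and> v' = 0)" using rel' by (auto simp: toric_rel_def)
    then have "mdeg m u' + mdeg m v' > 0"
      using mdeg_eq_0_iff[OF supps(3)] mdeg_eq_0_iff[OF supps(4)] by linarith
    then have "toric_rel m a d e \<Longrightarrow> monomial d - monomial e \<in> J"
      by (intro less.hyps) (simp_all add: d e mdeg_add)
    moreover have "d = e \<Longrightarrow> monomial d - monomial e \<in> J"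
      using additive_subgroup.zero_closed[OF J.is_additive_subgroup] by simp
    ultimately have 2: "monomial d - monomial e \<in> J"
      using supps exps unfolding toric_rel_def by blast
    have "monomial d * (monomial u' - monomial v') + monomial v' * (monomial d - monomial e) \<in> J"
      using additive_subgroup.a_closed[OF J.is_additive_subgroup
          J.I_l_closed[OF 1, of "monomial d"] J.I_l_closed[OF 2, of "monomial v'"]]
        supps by simp
    also have "monomial d * (monomial u' - monomial v') + monomial v' * (monomial d - monomial e)
        = (monomial u - monomial v :: 'k mpoly)"
      by (simp add: right_diff_distrib monomial_mult d e add.commute)
    finally show ?thesis .
  qed (rule prim)
qed

lemma single_mult_binomial:
  "Poly_Mapping.single 0 c * (monomial u - monomial v) =
    (Poly_Mapping.single u c - Poly_Mapping.single v c :: ('k::field) mpoly)"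
  by (simp add: right_diff_distrib mult_single)

text \<open>Induction on the number of terms: subtracting a scalar multiple of the binomial of two
  terms with the same image removes a term and creates none.\<close>

lemma toric_ideal_subset:
  fixes J :: "('k::field) mpoly set"
  assumes J: "ideal J (poly_ring m)"
    and bin: "\<And>u v. toric_rel m a u v \<Longrightarrow> monomial u - monomial v \<in> J"
  shows "toric_ideal m n a \<subseteq> J"
proof
  interpret J: ideal J "poly_ring m" by (fact J)
  fix p :: "'k mpoly" assume "p \<in> toric_ideal m n a"
  then show "p \<in> J"
  proof (induction "card (Poly_Mapping.keys p)" arbitrary: p rule: less_induct)
    case less
    show ?case
    proof (cases "p = 0")
      case True
      then show ?thesis using additive_subgroup.zero_closed[OF J.is_additive_subgroup] by simp
    next
      case False
      then obtain u where u: "u \<in> Poly_Mapping.keys p" by (metis all_not_in_conv keys_eq_empty)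
      define c where "c = Poly_Mapping.lookup p u"
      have c: "c \<noteq> 0" using u by (simp add: c_def in_keys_iff)
      have supps: "\<forall>w\<in>Poly_Mapping.keys p. supp w \<subseteq> {1..m}"
        and p: "toric_map a p = 0"
        using less.prems unfolding mem_toric_ideal by simp_all
      \<comment> \<open>The image of the term at \<open>u\<close> has to be cancelled by another term.\<close>
      have "\<exists>v\<in>Poly_Mapping.keys p. v \<noteq> u \<and> toric_exp a v = toric_exp a u"
      proof (rule ccontr)
        assume no: "\<not> ?thesis"
        have "toric_map a p =
            (\<Sum>v\<in>Poly_Mapping.keys p. Poly_Mapping.single (toric_exp a v) (Poly_Mapping.lookup p v))"
          unfolding toric_map_def[of a p]
          by (simp only: toric_map_single[symmetric] toric_map_single_exp)
        then have "Poly_Mapping.lookup (toric_map a p) (toric_exp a u) =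
            (\<Sum>v\<in>Poly_Mapping.keys p. Poly_Mapping.lookup p v when toric_exp a v = toric_exp a u)"
          by (simp add: lookup_sum lookup_single)
        also have "\<dots> = (\<Sum>v\<in>{u}. Poly_Mapping.lookup p v when toric_exp a v = toric_exp a u)"
          by (rule sum.mono_neutral_right) (use no u in \<open>auto simp: when_def\<close>)
        finally show False using c p by (simp add: c_def)
      qed
      then obtain v where v: "v \<in> Poly_Mapping.keys p" "v \<noteq> u" "toric_exp a v = toric_exp a u" by blast
      have rel: "toric_rel m a u v" using u v supps by (auto simp: toric_rel_def)
      \<comment> \<open>At \<open>u\<close> the coefficient of \<open>b\<close> is that of
        \<open>p\<close>, so \<open>p - b\<close> has no term there; the other term of
        \<open>b\<close> sits at \<open>v\<close>, already a key of \<open>p\<close>.\<close>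
      define b where "b = (Poly_Mapping.single u c - Poly_Mapping.single v c :: 'k mpoly)"
      have b: "b \<in> J"
        using J.I_l_closed[OF bin[OF rel], of "Poly_Mapping.single 0 c"]
        by (auto simp: b_def single_mult_binomial)
      have keys: "Poly_Mapping.keys (p - b) \<subseteq> Poly_Mapping.keys p - {u}"
        using u v by (auto simp: b_def c_def in_keys_iff lookup_minus lookup_single when_def
            split: if_splits)
      have "toric_map a p = toric_map a (p - b) + toric_map a b"
        by (simp flip: toric_map_add)
      moreover have "toric_map a b = 0" by (simp add: b_def toric_map_binomial v)
      ultimately have "p - b \<in> toric_ideal m n a"
        using keys supps p by (auto simp: mem_toric_ideal)
      moreover have "card (Poly_Mapping.keys (p - b)) < card (Poly_Mapping.keys p)"
        using keys u by (intro psubset_card_mono) auto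
      ultimately have "p - b \<in> J" using less.hyps by blast
      from additive_subgroup.a_closed[OF J.is_additive_subgroup this b] show ?thesis by simp
    qed
  qed
qed

subsection \<open>Minimality\<close>

text \<open>Multiplication only enlarges monomials, so a polynomial avoiding a divisor-closed set
  \<open>D\<close> avoids it in all its multiples. Such an ideal serves as a certificate of
  non-membership.\<close>

lemma ideal_keys:
  assumes "\<And>w d. w + d \<in> D \<Longrightarrow> w \<in> D"
  shows "ideal {p. (\<forall>w\<in>Poly_Mapping.keys p. supp w \<subseteq> {1..m}) \<and> Poly_Mapping.keys p \<inter> D = {}}
    (poly_ring m :: ('k::field) mpoly ring)" (is "ideal ?J ?R")
proof -
  interpret R: cring ?R by (rule cring_poly_ring)
  have mult: "x * y \<in> ?J" if "x \<in> ?J" "y \<in> carrier ?R" for x y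
  proof -
    have "w \<notin> D" if w: "w \<in> Poly_Mapping.keys (x * y)" for w
    proof -
      from w obtain v d where "v \<in> Poly_Mapping.keys x" "w = v + d"
        using keys_mult[of x y] by blast
      then show ?thesis using assms \<open>x \<in> ?J\<close> by blast
    qed
    moreover have "\<forall>w\<in>Poly_Mapping.keys (x * y). supp w \<subseteq> {1..m}"
      using that by (intro poly_ring_mult_closed) simp_all
    ultimately show ?thesis by blast
  qed
  \<comment> \<open>The abstract inverse of the ring record has to be identified with the minus of
    the type.\<close>
  have uminus: "\<ominus>\<^bsub>?R\<^esub> x = - x" if "x \<in> carrier ?R" for x
    by (rule sym, rule R.sum_zero_eq_neg) (use that in \<open>simp_all add: keys_uminus_poly\<close>)
  have "subgroup ?J (add_monoid ?R)"
  proof (rule R.add.subgroupI)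
    show "?J \<subseteq> carrier ?R" by auto
    show "?J \<noteq> {}" by (auto intro: exI[of _ 0])
  next
    fix x :: "'k mpoly" assume "x \<in> ?J"
    then show "\<ominus>\<^bsub>?R\<^esub> x \<in> ?J" by (simp add: uminus keys_uminus_poly)
  next
    fix x y :: "'k mpoly" assume "x \<in> ?J" "y \<in> ?J"
    then show "x \<oplus>\<^bsub>?R\<^esub> y \<in> ?J" using keys_add[of x y] by fastforce
  qed
  then show ?thesis
  proof (rule idealI[OF R.ring_axioms])
    fix x y :: "'k mpoly" assume "x \<in> ?J" "y \<in> carrier ?R"
    then show "x \<otimes>\<^bsub>?R\<^esub> y \<in> ?J" "y \<otimes>\<^bsub>?R\<^esub> x \<in> ?J"
      using mult[of x y] by (simp_all only: poly_ring_simps(2) mult.commute)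
  qed
qed

text \<open>The ideal of polynomials with no monomial dividing \<open>u\<close> separates the two:
  it contains \<open>C\<close> by \<open>prim_eq_if_mon_le\<close>, but not
  \<open>u - v\<close>.\<close>

lemma prim_not_mem_genideal:
  fixes C :: "('k::field) mpoly set"
  assumes "paired m a" and uv: "prim m a u v"
    and C: "\<And>g. g \<in> C \<Longrightarrow> primitive_binomial (toric_ideal m n a) g"
    and "monomial u - monomial v \<notin> C" and "monomial v - monomial u \<notin> C"
  shows "monomial u - monomial v \<notin> Idl\<^bsub>poly_ring m\<^esub> C"
proof -
  interpret R: cring "poly_ring m :: 'k mpoly ring" by (rule cring_poly_ring)
  let ?D = "{w. mon_le w u}"
  let ?J = "{p :: 'k mpoly. (\<forall>w\<in>Poly_Mapping.keys p. supp w \<subseteq> {1..m}) \<and> Poly_Mapping.keys p \<inter> ?D = {}}"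
  have "ideal ?J (poly_ring m)"
    by (rule ideal_keys) (auto simp: mon_le_def lookup_add intro: add_leD1)
  moreover have "C \<subseteq> ?J"
  proof
    fix g assume g: "g \<in> C"
    then obtain u' v' where g_eq: "g = monomial u' - monomial v'" and uv': "prim m a u' v'"
      using C primitive_binomial_iff by blast
    have rel: "toric_rel m a u' v'" using uv' by (simp add: prim_def)
    \<comment> \<open>If \<open>u'\<close> divided \<open>u\<close>, then \<open>g\<close> would be
      \<open>u - v\<close>; if \<open>v'\<close> did, the exchanged pair shows that \<open>g\<close>
      would be \<open>v - u\<close>.\<close>
    have "\<not> mon_le u' u" using prim_eq_if_mon_le[OF assms(1) uv uv'] g g_eq assms(4) by blast
    moreover have "\<not> mon_le v' u"
      using prim_eq_if_mon_le[OF assms(1) uv prim_sym[OF uv']] g g_eq assms(5) by blast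
    ultimately show "g \<in> ?J" using rel by (auto simp: g_eq toric_rel_def keys_binomial)
  qed
  ultimately have "Idl\<^bsub>poly_ring m\<^esub> C \<subseteq> ?J" by (rule R.genideal_minimal)
  moreover have "monomial u - monomial v \<notin> ?J"
    using uv mon_le_refl by (auto simp: prim_def toric_rel_def keys_binomial)
  ultimately show ?thesis by blast
qed

section \<open>Strong robustness from the pairing\<close>

lemma strongly_robust_if_paired:
  assumes "paired m a" and supp_a: "\<And>i. i \<in> {1..m} \<Longrightarrow> supp (a i) \<subseteq> {1..n}"
  shows "strongly_robust m (toric_ideal m n a :: ('k::field) mpoly set)"
  unfolding strongly_robust_def minimal_generating_set_def
proof (intro allI impI conjI)
  interpret R: cring "poly_ring m :: 'k mpoly ring" by (rule cring_poly_ring)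
  interpret S: cring "poly_ring n :: 'k mpoly ring" by (rule cring_poly_ring)
  interpret h: ring_hom_ring "poly_ring m :: 'k mpoly ring" "poly_ring n" "toric_map a"
    by (intro ring_hom_ringI2 R.ring_axioms S.ring_axioms toric_map_ring_hom supp_a)
  let ?I = "toric_ideal m n a :: 'k mpoly set"
  have ideal_I: "ideal ?I (poly_ring m)"
    unfolding toric_ideal_def by (rule h.kernel_is_ideal)
  fix B assume B: "graver_basis ?I B"
  then have prim_B: "primitive_binomial ?I g" if "g \<in> B" for g
    using that by (simp add: graver_basis_def)
  have rep: "\<exists>!g. g \<in> B \<and> (g = f \<or> g = - f)" if "primitive_binomial ?I f" for f
    using that B by (simp add: graver_basis_def)
  from prim_B have B_I: "B \<subseteq> ?I" by (auto simp: primitive_binomial_def)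
  also have "?I \<subseteq> carrier (poly_ring m)"
    by (intro subsetI) (simp add: mem_toric_ideal)
  finally show B_R: "B \<subseteq> carrier (poly_ring m)" .
  interpret J: ideal "Idl\<^bsub>poly_ring m\<^esub> B" "poly_ring m" by (rule R.genideal_ideal[OF B_R])
  \<comment> \<open>\<open>B\<close> holds one representative of \<open>{f, - f}\<close>; the other
    sign is recovered inside the ideal.\<close>
  have minus: "- f \<in> Idl\<^bsub>poly_ring m\<^esub> B" if "f \<in> Idl\<^bsub>poly_ring m\<^esub> B" for f
    using J.I_l_closed[OF that, of "- 1"] by (simp add: keys_uminus_poly)
  have "monomial u - monomial v \<in> Idl\<^bsub>poly_ring m\<^esub> B" if "prim m a u v" for u v
  proof -
    let ?f = "monomial u - monomial v :: 'k mpoly"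
    have "primitive_binomial ?I ?f" using that primitive_binomial_iff by blast
    then have "?f \<in> B \<or> - ?f \<in> B" using rep by metis
    then have "?f \<in> Idl\<^bsub>poly_ring m\<^esub> B \<or> - ?f \<in> Idl\<^bsub>poly_ring m\<^esub> B"
      using R.genideal_self[OF B_R] by blast
    then show ?thesis using minus[of "- ?f"] by (metis minus_minus)
  qed
  then have "?I \<subseteq> Idl\<^bsub>poly_ring m\<^esub> B"
    using toric_ideal_subset[OF J.ideal_axioms] binomial_mem_of_prim[OF J.ideal_axioms] by metis
  with R.genideal_minimal[OF ideal_I B_I] show "Idl\<^bsub>poly_ring m\<^esub> B = ?I" by blast
  fix C assume "C \<subset> B"
  then obtain f where f: "f \<in> B" "f \<notin> C" and C: "C \<subseteq> B" by blast
  then obtain u v where uv: "prim m a u v" "f = monomial u - monomial v"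
    using prim_B primitive_binomial_iff by blast
  \<comment> \<open>By uniqueness of representatives, \<open>- f\<close> lies in \<open>B\<close>
    only if it equals \<open>f\<close>, as in characteristic 2. So omitting \<open>f\<close> omits
    both signs.\<close>
  have "- f \<in> B \<Longrightarrow> - f = f"
    using rep[OF prim_B[OF f(1)]] f(1) by metis
  then have "- f \<notin> C" using f(2) C by (metis subsetD)
  then have "f \<notin> Idl\<^bsub>poly_ring m\<^esub> C"
    using prim_not_mem_genideal[OF assms(1) uv(1), of C n] f(2) C prim_B by (auto simp: uv(2))
  moreover have "f \<in> ?I" using f B_I by blast
  ultimately show "Idl\<^bsub>poly_ring m\<^esub> C \<noteq> ?I" by blast
qed

theorem theorem3p8:
  fixes n m :: nat
    and M :: "('k::field) mpoly set"
    and a :: "nat \<Rightarrow> nat \<Rightarrow>\<^sub>0 nat"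
  assumes "monomial_ideal n M"
    and "inj_on a {1..m}"
    and "minimal_generating_set (poly_ring n) M ((\<lambda>i. monomial (a i)) ` {1..m})"
    and "\<forall>i\<in>{1..m}. card (supp (a i)) = 2"
    and "\<forall>i\<in>{1..m}. \<exists>l\<in>supp (a i). \<exists>j\<in>{1..m}. a j \<noteq> a i \<and>
           l \<in> supp (a i) \<inter> supp (a j) \<and>
           (\<forall>k\<in>{1..m}. k \<noteq> i \<and> k \<noteq> j \<longrightarrow> l \<notin> supp (a k))"
  shows "strongly_robust m (toric_ideal m n a :: 'k mpoly set)"
proof (rule strongly_robust_if_paired)
  \<comment> \<open>Distinct generators have distinct indices.\<close>
  show "paired m a" unfolding paired_def using assms(5) by (metis IntD2)
  fix i assume "i \<in> {1..m}"
  then have "monomial (a i) \<in> carrier (poly_ring n :: 'k mpoly ring)"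
    using assms(3) unfolding minimal_generating_set_def by blast
  then show "supp (a i) \<subseteq> {1..n}" by simp
qed

end
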